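(* Consider continuous $n$-player Guts, $n\ge4$, and put $p_\circ=(1/2)^{1/(n-1)}$. There is a fixed $\delta>0$ such that for all sufficiently large $C>0$ and all sufficiently small $\varepsilon>0$ (depending on $C$) the following holds. Let $A$ be the joint pure strategy $p_2^*=\dots=p_n^*=p_\circ-\varepsilon$ and $B$ the joint pure strategy $(p_2^*,\dots,p_n^* )=(0,\,p_\circ+\delta,\dots,p_\circ+\delta)$ of players 2-$n$. Then the mixed strategy $(1-C\varepsilon^2)A+C\varepsilon^2B$ (play $A$ with probability $1-C\varepsilon^2$ and $B$ with probability $C\varepsilon^2$) returns $\alpha<0$ and $\beta\le\beta_0$, for some constant $\beta_0<1$, for all $p_1^*\in[0,1]$; and therefore it is a winning strategy for players 2-$n$.
   Context: Continuous $n$-player Guts: players $1,\dots,n$ receive independent hands $p_1,\dots,p_n$ uniform on $[0,1]$. A pure strategy of player $i$ is a threshold $p_i^*\in[0,1]$: hold if $p_i\ge p_i^*$, drop if $p_i<p_i^*$. Each ante is one unit, so the pot is $n$. Let $r$ be the number of holding players. If $r=0$, the immediate return to each player is $0$ and the game is replayed with stakes factor $1$. If $r\ge1$, the stakes factor for the replay is $r-1$ (factor $0$ means the game ends) and a player's immediate return is $(r-2)+n$ if the player holds and has the highest hand among holders, $(r-2)-n$ if the player holds but does not have the highest hand, and $r-2$ if the player drops. $\alpha(p_1^*,\dots,p_n^* )$ is the expected immediate return to player 1 (minus the joint immediate return of players 2-$n$), $\beta(p_1^*,\dots,p_n^* )$ the expected stakes factor; for a mixed joint strategy $\nu$ of players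 2-$n$ (a probability measure on tuples $(p_2^*,\dots,p_n^* )$), $\alpha(p_1^*,\nu)$ and $\beta(p_1^*,\nu)$ are the averages. Winning strategy for players 2-$n$: early exit costs a fee of $1$ times current stakes. Put $h_0=1$, $h_{k+1}=\sup_{p\in[0,1]}[\alpha(p,\nu)+\beta(p,\nu)h_k]$, the upper bound on player 1's return that players 2-$n$ force by repeating $\nu$ in the $k$-truncated game. The strategy $\nu$ is winning if $\inf_kh_k<0$, i.e. it forces a strictly negative return for player 1 and a strictly positive joint return for players 2-$n$. *)

theory Defs
  imports "HOL-Probability.Probability"
begin

text \<open>
  Players are \<open>1, \<dots>, n\<close>. A vector \<open>t\<close> gives the thresholds of all players, a vector \<open>p\<close> their hands;
  only the components in \<open>{1..n}\<close> matter.
\<close>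

definition hands :: "nat \<Rightarrow> (nat \<Rightarrow> real) measure" where
  "hands n = (\<Pi>\<^sub>M i\<in>{1..n}. uniform_measure lborel {0..1})"

definition holders :: "nat \<Rightarrow> (nat \<Rightarrow> real) \<Rightarrow> (nat \<Rightarrow> real) \<Rightarrow> nat set" where
  "holders n t p = {i \<in> {1..n}. t i \<le> p i}"

definition stakes_factor :: "nat \<Rightarrow> (nat \<Rightarrow> real) \<Rightarrow> (nat \<Rightarrow> real) \<Rightarrow> real" where
  "stakes_factor n t p =
     (let r = card (holders n t p) in if r = 0 then 1 else real r - 1)"

text \<open>
  Ties for the highest hand have probability zero, so it does not matter that each of the tied
  players is treated as a winner. Without ties the returns of the \<open>n\<close> players sum to zero, so the
  return to player 1 is minus the joint return of players \<open>2, \<dots>, n\<close>.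
\<close>

definition immediate_return ::
    "nat \<Rightarrow> (nat \<Rightarrow> real) \<Rightarrow> (nat \<Rightarrow> real) \<Rightarrow> nat \<Rightarrow> real" where
  "immediate_return n t p i =
     (let H = holders n t p; r = card H in
      if r = 0 then 0
      else if i \<notin> H then real r - 2
      else if \<forall>j\<in>H. p j \<le> p i then (real r - 2) + real n
      else (real r - 2) - real n)"

text \<open>
  In the following, \<open>q\<close> is a joint pure strategy of players \<open>2, \<dots>, n\<close> and \<open>p1\<close> the threshold of
  player 1.
\<close>

definition alpha :: "nat \<Rightarrow> real \<Rightarrow> (nat \<Rightarrow> real) \<Rightarrow> real" where
  "alpha n p1 q = (\<integral>p. immediate_return n (q(1 := p1)) p 1 \<partial>hands n)"

definition beta :: "nat \<Rightarrow> real \<Rightarrow> (nat \<Rightarrow> real) \<Rightarrow> real" where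
  "beta n p1 q = (\<integral>p. stakes_factor n (q(1 := p1)) p \<partial>hands n)"

definition joint_strategy_space :: "nat \<Rightarrow> (nat \<Rightarrow> real) measure" where
  "joint_strategy_space n = (\<Pi>\<^sub>M i\<in>{2..n}. restrict_space borel {0..1})"

definition mixed_joint_strategy :: "nat \<Rightarrow> (nat \<Rightarrow> real) measure \<Rightarrow> bool" where
  "mixed_joint_strategy n \<nu> \<longleftrightarrow> prob_space \<nu> \<and> sets \<nu> = sets (joint_strategy_space n)"

definition alpha_mixed :: "nat \<Rightarrow> real \<Rightarrow> (nat \<Rightarrow> real) measure \<Rightarrow> real" where
  "alpha_mixed n p1 \<nu> = (\<integral>q. alpha n p1 q \<partial>\<nu>)"

definition beta_mixed :: "nat \<Rightarrow> real \<Rightarrow> (nat \<Rightarrow> real) measure \<Rightarrow> real" where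
  "beta_mixed n p1 \<nu> = (\<integral>q. beta n p1 q \<partial>\<nu>)"

primrec forced_bound :: "nat \<Rightarrow> (nat \<Rightarrow> real) measure \<Rightarrow> nat \<Rightarrow> real" where
  "forced_bound n \<nu> 0 = 1"
| "forced_bound n \<nu> (Suc k) =
     (SUP p\<in>{0..1}. alpha_mixed n p \<nu> + beta_mixed n p \<nu> * forced_bound n \<nu> k)"

text \<open>The infimum is taken in \<open>ereal\<close> because the bounds may tend to \<open>-\<infinity>\<close>.\<close>

definition winning_strategy :: "nat \<Rightarrow> (nat \<Rightarrow> real) measure \<Rightarrow> bool" where
  "winning_strategy n \<nu> \<longleftrightarrow>
     mixed_joint_strategy n \<nu> \<and> (INF k. ereal (forced_bound n \<nu> k)) < 0"

text \<open>Play \<open>A\<close> with probability \<open>1 - w\<close> and \<open>B\<close> with probability \<open>w\<close>, for \<open>0 \<le> w \<le> 1\<close>.\<close>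

definition two_point_mix ::
    "nat \<Rightarrow> real \<Rightarrow> (nat \<Rightarrow> real) \<Rightarrow> (nat \<Rightarrow> real) \<Rightarrow> (nat \<Rightarrow> real) measure" where
  "two_point_mix n w A B =
     distr (measure_pmf (bernoulli_pmf w)) (joint_strategy_space n) (\<lambda>b. if b then B else A)"

definition p_circ :: "nat \<Rightarrow> real" where
  "p_circ n = (1/2) powr (1 / (real n - 1))"

definition strategy_A :: "nat \<Rightarrow> real \<Rightarrow> nat \<Rightarrow> real" where
  "strategy_A n \<epsilon> = (\<lambda>i\<in>{2..n}. p_circ n - \<epsilon>)"

definition strategy_B :: "nat \<Rightarrow> real \<Rightarrow> nat \<Rightarrow> real" where
  "strategy_B n \<delta> = (\<lambda>i\<in>{2..n}. if i = 2 then 0 else p_circ n + \<delta>)"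

end

theory Submission imports Defs begin

text \<open>
  Write \<open>r\<close> for \<open>p_circ n\<close> and \<open>m = n - 1\<close>, so \<open>r ^ m = 1/2\<close>. With \<open>q\<close> the thresholds of the
  opponents, integration over the hands gives
  \<open>beta = (\<Sum>i. 1 - q i) - p + 2 p (\<Prod>i. q i)\<close> and
  \<open>alpha = beta - 1 + n \<integral>\<^sub>p\<^sup>1 (2 (\<Prod>i. max (q i) x) - 1) dx\<close>. Everything else is the study of these two
  functions of \<open>p\<close>.

  If all opponents use the threshold \<open>r\<close>, then \<open>alpha\<close> vanishes for \<open>p \<le> r\<close> and is negative
  beyond, so this strategy only breaks even. Lowering the common threshold to \<open>a = r - \<epsilon>\<close> tilts
  the flat part: \<open>alpha\<close> becomes linear on \<open>[0, a]\<close> with a slope of order \<open>\<epsilon>\<close> and the value \<open>0\<close>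
  at \<open>a\<close>, and to the right of \<open>a\<close> it grows with slope \<open>O(\<epsilon>)\<close> before a concave quadratic term
  takes over. Hence player 1 gains at most \<open>O(\<epsilon>\<^sup>2)\<close> anywhere, and loses at least a multiple of
  \<open>\<epsilon>\<close> at a fixed distance from \<open>r\<close> (\<open>alpha_strategy_A_le\<close>, \<open>alpha_strategy_A_far\<close>).

  The strategy \<open>B\<close> repairs the \<open>O(\<epsilon>\<^sup>2)\<close> gap. With thresholds \<open>(0, r, \<dots>, r)\<close> a player 1 at \<open>r\<close>
  also breaks even; raising the thresholds \<open>r\<close> to \<open>r + \<delta>\<close> changes \<open>alpha\<close> there by
  \<open>- (n - 2) \<delta>\<close> to first order, since the integral changes only to second order
  (\<open>alpha_strategy_B_le\<close>). So \<open>B\<close> is a strict loss for player 1 at \<open>r\<close>, and near \<open>r\<close> by Lipschitz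
  continuity. Giving \<open>B\<close> the weight \<open>C \<epsilon>\<^sup>2\<close> with \<open>C\<close> large beats the gain near \<open>r\<close>, while
  away from \<open>r\<close> the weight is too small to spoil the loss of order \<open>\<epsilon>\<close>.

  For \<open>beta\<close>, the expected number of holders among the opponents at the threshold \<open>r\<close> is at most
  \<open>r < 1\<close>, which leaves room for both perturbations. Finally, an \<open>alpha\<close> bounded away from
  \<open>0\<close> together with \<open>0 \<le> beta \<le> \<beta>\<^sub>0 < 1\<close> makes the recursion for the forced bounds a contraction
  towards a negative value (\<open>winning_strategyI\<close>).
\<close>

section \<open>Hands and expected payoffs\<close>

abbreviation hand :: "real measure" where
  "hand \<equiv> uniform_measure lborel {0..1}"

interpretation hand: prob_space hand
  by (rule prob_space_uniform_measure) auto

interpretation iid_hands: product_prob_space "\<lambda>_. hand" I for I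
  by standard

lemma prob_space_hands: "prob_space (hands n)"
  unfolding hands_def by (rule prob_space_PiM) (rule hand.prob_space_axioms)

lemma sets_hands [measurable_cong]: "sets (hands n) = sets (\<Pi>\<^sub>M i\<in>{1..n}. borel)"
  unfolding hands_def by (rule sets_PiM_cong) auto

lemma measure_hand:
  assumes "A \<in> sets borel"
  shows "measure hand A = measure lborel ({0..1} \<inter> A)"
  using assms by (subst measure_uniform_measure) auto

text \<open>An opponent with threshold \<open>a\<close> fails to beat the hand \<open>b\<close> iff they drop or their hand is at most \<open>b\<close>.\<close>

lemma measure_hand_below:
  assumes "a \<in> {0..1}" "b \<in> {0..1}"
  shows "measure hand ({..<a} \<union> {..b}) = max a b"
proof -
  have "{0..1} \<inter> ({..<a} \<union> {..b}) = (if b < a then {0..<a} else {0..b})"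
    using assms by auto
  thus ?thesis using assms by (subst measure_hand) auto
qed

lemma measure_hand_lessThan: "a \<in> {0..1} \<Longrightarrow> measure hand {..<a} = a"
proof -
  assume "a \<in> {0..1}"
  moreover from this have "{0..1} \<inter> {..<a} = {0..<a}" by auto
  ultimately show ?thesis by (subst measure_hand) auto
qed

lemma measure_hand_atLeast: "a \<in> {0..1} \<Longrightarrow> measure hand {a..} = 1 - a"
proof -
  assume "a \<in> {0..1}"
  moreover from this have "{0..1} \<inter> {a..} = {a..1}" by auto
  ultimately show ?thesis by (subst measure_hand) auto
qed

lemma integral_hand:
  fixes f :: "real \<Rightarrow> real"
  assumes [measurable]: "f \<in> borel_measurable borel" and "set_integrable lborel {0..1} f"
  shows "(\<integral>x. f x \<partial>hand) = integral {0..1} f"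
proof -
  have *: "(\<lambda>x. indicator {0..1} x / emeasure lborel {0..1::real}) = (\<lambda>x. ennreal (indicator {0..1} x))"
    by (auto simp: fun_eq_iff indicator_def)
  have "(\<integral>x. f x \<partial>hand) = (\<integral>x\<in>{0..1}. f x \<partial>lborel)"
    unfolding uniform_measure_def set_lebesgue_integral_def *
    by (subst integral_density) auto
  also have "\<dots> = integral {0..1} f"
    by (rule set_borel_integral_eq_integral) fact
  finally show ?thesis .
qed

lemma integral_hands_component:
  fixes f :: "real \<Rightarrow> real"
  assumes [measurable]: "f \<in> borel_measurable borel" and "i \<in> {1..n}"
  shows "(\<integral>p. f (p i) \<partial>hands n) = (\<integral>x. f x \<partial>hand)"
proof -
  have "hand = distr (hands n) hand (\<lambda>p. p i)"
    using iid_hands.PiM_component[of i "{1..n}"] assms by (simp add: hands_def)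
  hence "(\<integral>x. f x \<partial>hand) = (\<integral>x. f x \<partial>distr (hands n) hand (\<lambda>p. p i))" by simp
  also have "\<dots> = (\<integral>p. f (p i) \<partial>hands n)"
    by (rule integral_distr) (use assms(2) in measurable)
  finally show ?thesis by simp
qed

text \<open>
  The case distinction disappears because the summand \<open>2\<close> turns the value \<open>- 1\<close> of \<open>r - 1\<close> at
  \<open>r = 0\<close> into \<open>1\<close>. What remains is a sum and a product of functions of
  single hands, so linearity and independence give the expectation.
\<close>

lemma stakes_factor_eq:
  "stakes_factor n t p =
     (\<Sum>i\<in>{1..n}. indicat_real {t i..} (p i)) - 1 + 2 * (\<Prod>i\<in>{1..n}. indicat_real {..<t i} (p i))"
proof -
  have card: "(\<Sum>i\<in>{1..n}. indicat_real {t i..} (p i)) = real (card (holders n t p))"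
  proof -
    have "(\<Sum>i\<in>{1..n}. indicat_real {t i..} (p i)) = (\<Sum>i\<in>{1..n}. if t i \<le> p i then 1 else 0)"
      by (intro sum.cong) (auto simp: indicator_def)
    also have "\<dots> = real (card ({1..n} \<inter> {i. t i \<le> p i}))"
      by (subst sum.If_cases) auto
    also have "{1..n} \<inter> {i. t i \<le> p i} = holders n t p"
      by (auto simp: holders_def)
    finally show ?thesis .
  qed
  show ?thesis
  proof (cases "holders n t p = {}")
    case True
    hence "(\<Prod>i\<in>{1..n}. indicat_real {..<t i} (p i)) = 1"
      by (intro prod.neutral) (force simp: holders_def)
    with True show ?thesis unfolding stakes_factor_def card by simp
  next
    case False
    then obtain i where "i \<in> {1..n}" "t i \<le> p i" by (auto simp: holders_def)
    hence "(\<Prod>i\<in>{1..n}. indicat_real {..<t i} (p i)) = 0"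
      by (intro prod_zero) (auto intro!: bexI[of _ i])
    moreover have "card (holders n t p) \<noteq> 0" using False by (simp add: holders_def)
    ultimately show ?thesis unfolding stakes_factor_def card by (simp add: Let_def)
  qed
qed

text \<open>
  A tie for the highest hand counts as a win, so an opponent beats player 1 only with a strictly
  larger hand; the identity holds pointwise, without an exceptional null set.
\<close>

lemma immediate_return_eq:
  assumes "n \<ge> 1"
  shows "immediate_return n t p 1 = stakes_factor n t p - 1 +
     real n * (indicat_real {t 1..} (p 1) *
       (2 * (\<Prod>i\<in>{2..n}. indicat_real ({..<t i} \<union> {..p 1}) (p i)) - 1))"
proof -
  have one: "1 \<in> holders n t p \<longleftrightarrow> t 1 \<le> p 1" using assms by (auto simp: holders_def)
  show ?thesis
  proof (cases "t 1 \<le> p 1")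
    case False
    thus ?thesis using one
      by (auto simp: immediate_return_def stakes_factor_def Let_def holders_def)
  next
    case True
    with one have c: "card (holders n t p) \<noteq> 0" by (auto simp: holders_def)
    have win: "(\<Prod>i\<in>{2..n}. indicat_real ({..<t i} \<union> {..p 1}) (p i)) =
        (if \<forall>j\<in>holders n t p. p j \<le> p 1 then 1 else 0)"
    proof (cases "\<forall>j\<in>holders n t p. p j \<le> p 1")
      case T: True
      hence "p i \<in> {..<t i} \<union> {..p 1}" if "i \<in> {2..n}" for i
        using that by (cases "t i \<le> p i") (auto simp: holders_def)
      hence "(\<Prod>i\<in>{2..n}. indicat_real ({..<t i} \<union> {..p 1}) (p i)) = 1"
        by (intro prod.neutral ballI) (simp only: indicator_simps)
      with T show ?thesis by simp
    next
      case False
      then obtain j where j: "j \<in> holders n t p" "\<not> p j \<le> p 1" by blast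
      moreover from this have "j \<noteq> 1" by auto
      ultimately have "j \<in> {2..n}" "indicat_real ({..<t j} \<union> {..p 1}) (p j) = 0"
        by (auto simp: holders_def)
      hence "(\<Prod>i\<in>{2..n}. indicat_real ({..<t i} \<union> {..p 1}) (p i)) = 0"
        by (intro prod_zero) auto
      with False show ?thesis by auto
    qed
    show ?thesis using c one True
      by (simp add: immediate_return_def stakes_factor_def Let_def win del: One_nat_def)
  qed
qed

lemma stakes_factor_measurable [measurable]: "stakes_factor n t \<in> borel_measurable (hands n)"
  unfolding stakes_factor_eq[abs_def] by measurable

lemma stakes_factor_integrable: "integrable (hands n) (stakes_factor n t)"
proof -
  interpret prob_space "hands n" by (rule prob_space_hands)
  show ?thesis
  proof (rule integrable_const_bound[where B = "1 + real n"])
    have "card (holders n t p) \<le> n" for p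
    proof -
      have "holders n t p \<subseteq> {1..n}" by (auto simp: holders_def)
      from card_mono[OF _ this] show ?thesis by simp
    qed
    hence "real (card (holders n t p)) \<le> real n" for p by (rule of_nat_mono)
    hence "norm (stakes_factor n t p) \<le> 1 + real n" for p
      using order_trans[of "real (card (holders n t p))" "real n" "2 + real n"]
      by (auto simp: stakes_factor_def Let_def)
    thus "AE p in hands n. norm (stakes_factor n t p) \<le> 1 + real n"
      by (intro AE_I2)
  qed measurable
qed

lemma stakes_factor_nonneg: "stakes_factor n t p \<ge> 0"
  by (auto simp: stakes_factor_def Let_def)

lemma beta_eq:
  assumes n: "n \<ge> 1" and p: "p \<in> {0..1}" and q: "\<And>i. i \<in> {2..n} \<Longrightarrow> q i \<in> {0..1}"
  shows "beta n p q = (\<Sum>i\<in>{2..n}. 1 - q i) - p + 2 * p * (\<Prod>i\<in>{2..n}. q i)"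
proof -
  interpret prob_space "hands n" by (rule prob_space_hands)
  define t where "t = q(1 := p)"
  have t: "t i \<in> {0..1}" if "i \<in> {1..n}" for i
    using that p q[of i] by (auto simp: t_def)
  have ind [simp]: "(\<integral>x. indicat_real A x \<partial>hand) = measure hand A" if "A \<in> sets borel" for A
    using that by simp
  have hold: "(\<integral>p. indicat_real {t i..} (p i) \<partial>hands n) = 1 - t i" if "i \<in> {1..n}" for i
    using integral_hands_component[of "indicat_real {t i..}" i n] that t[OF that]
      by (simp add: measure_hand_atLeast del: measure_uniform_measure)
  have holdI: "integrable (hands n) (\<lambda>p. indicat_real {t i..} (p i))" if "i \<in> {1..n}" for i
    by (rule integrable_const_bound[where B=1]) (use that in auto)
  have drop: "(\<integral>p. (\<Prod>i\<in>{1..n}. indicat_real {..<t i} (p i)) \<partial>hands n) = (\<Prod>i\<in>{1..n}. t i)"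
    unfolding hands_def using t
    by (subst iid_hands.product_integral_prod)
       (auto intro!: prod.cong hand.integrable_const_bound[where B=1] simp: measure_hand_lessThan simp del: measure_uniform_measure)
  have dropI: "integrable (hands n) (\<lambda>p. \<Prod>i\<in>{1..n}. indicat_real {..<t i} (p i))"
    unfolding hands_def
    by (rule iid_hands.product_integrable_prod) (auto intro!: hand.integrable_const_bound[where B=1])
  have "beta n p q = (\<Sum>i\<in>{1..n}. 1 - t i) - 1 + 2 * (\<Prod>i\<in>{1..n}. t i)"
  proof -
    have "beta n p q = (\<integral>p'. (\<Sum>i\<in>{1..n}. indicat_real {t i..} (p' i)) - 1
        + 2 * (\<Prod>i\<in>{1..n}. indicat_real {..<t i} (p' i)) \<partial>hands n)"
      unfolding beta_def t_def[symmetric] stakes_factor_eq ..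
    also have "\<dots> = (\<integral>p'. (\<Sum>i\<in>{1..n}. indicat_real {t i..} (p' i)) \<partial>hands n) - 1
        + 2 * (\<integral>p'. (\<Prod>i\<in>{1..n}. indicat_real {..<t i} (p' i)) \<partial>hands n)"
      using dropI Bochner_Integration.integrable_sum[OF holdI, of "{1..n}"]
      by (simp add: prob_space del: One_nat_def)
    also have "(\<integral>p'. (\<Sum>i\<in>{1..n}. indicat_real {t i..} (p' i)) \<partial>hands n) = (\<Sum>i\<in>{1..n}. 1 - t i)"
      by (subst Bochner_Integration.integral_sum[OF holdI]) (auto intro!: sum.cong hold)
    finally show ?thesis unfolding drop .
  qed
  moreover have "{1..n} = insert 1 {2..n}" using n by auto
  moreover have "(\<Sum>i\<in>{2..n}. 1 - t i) = (\<Sum>i\<in>{2..n}. 1 - q i)" "(\<Prod>i\<in>{2..n}. t i) = (\<Prod>i\<in>{2..n}. q i)"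
    by (auto simp: t_def intro!: sum.cong prod.cong)
  ultimately show ?thesis by (simp add: t_def)
qed

lemma beta_nonneg: "beta n p q \<ge> 0"
  unfolding beta_def by (rule Bochner_Integration.integral_nonneg) (rule stakes_factor_nonneg)

text \<open>
  Conditionally on the hand \<open>x\<close> of player 1, the events that the single opponents fail to beat \<open>x\<close>
  are independent with probabilities \<open>max (q i) x\<close>, so a holding player 1 wins \<open>n\<close> or loses \<open>n\<close>
  with mean \<open>n (2 (\<Prod>i. max (q i) x) - 1)\<close>.
\<close>

lemma alpha_eq:
  assumes n: "n \<ge> 1" and p: "p \<in> {0..1}" and q: "\<And>i. i \<in> {2..n} \<Longrightarrow> q i \<in> {0..1}"
  shows "alpha n p q = beta n p q - 1 +
           n * integral {p..1} (\<lambda>x. 2 * (\<Prod>i\<in>{2..n}. max (q i) x) - 1)"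
proof -
  interpret prob_space "hands n" by (rule prob_space_hands)
  define w where "w = (\<lambda>y x. \<Prod>i\<in>{2..n}. indicat_real ({..<q i} \<union> {..y}) (x i))"
  define F where "F = (\<lambda>p' :: nat \<Rightarrow> real. indicat_real {p..} (p' 1) * (2 * w (p' 1) p' - 1))"
  have w01: "w y x \<in> {0..1}" for y and x :: "nat \<Rightarrow> real"
    unfolding w_def by (auto intro!: prod_nonneg prod_le_1)
  have comp: "(\<lambda>x. x i) \<in> borel_measurable (hands n)" if "i \<in> {1..n}" for i
    using that by measurable
  have [measurable]: "Measurable.pred (hands n) (\<lambda>x. x i \<le> x 1)" if "i \<in> {2..n}" for i
    unfolding Measurable.pred_def by (intro borel_measurable_le comp) (use that n in auto)
  have win_meas: "(\<lambda>x. w (x 1) x) \<in> borel_measurable (hands n)"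
    unfolding w_def indicator_def Un_iff lessThan_iff atMost_iff using n by measurable
  have F_meas [measurable]: "F \<in> borel_measurable (hands n)"
    unfolding F_def using n by (intro borel_measurable_times borel_measurable_diff win_meas
      measurable_compose[OF comp borel_measurable_indicator]) auto
  have F_int: "integrable (hands n) F"
  proof (rule integrable_const_bound[where B=1])
    show "AE p' in hands n. norm (F p') \<le> 1"
      using w01 by (auto simp: F_def indicator_def abs_le_iff)
  qed (rule F_meas)
  define J where "J = (\<Pi>\<^sub>M i\<in>{2..n}. hand)"
  interpret J: prob_space J unfolding J_def by (rule prob_space_PiM) (rule hand.prob_space_axioms)
  have wI: "integrable J (w y)" for y
    unfolding w_def J_def 
    by (rule iid_hands.product_integrable_prod) (auto intro!: hand.integrable_const_bound[where B=1])
  have wE: "(\<integral>x. w y x \<partial>J) = (\<Prod>i\<in>{2..n}. max (q i) y)" if "y \<in> {0..1}" for y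
    unfolding w_def J_def using q that
    by (subst iid_hands.product_integral_prod)
       (auto intro!: prod.cong hand.integrable_const_bound[where B=1]
             simp: measure_hand_below simp del: measure_uniform_measure)
  have [measurable]: "(\<lambda>z. snd z i) \<in> borel_measurable (borel \<Otimes>\<^sub>M J)" if "i \<in> {2..n}"
    for i unfolding J_def by (rule measurable_compose[OF measurable_snd]) (use that in measurable)
  have [measurable]: "Measurable.pred (borel \<Otimes>\<^sub>M J) (\<lambda>z. snd z i \<le> fst z)" if "i \<in> {2..n}" for i
    unfolding Measurable.pred_def by (intro borel_measurable_le) (use that in measurable)
  have [measurable]: "(\<lambda>z. w (fst z) (snd z)) \<in> borel_measurable (borel \<Otimes>\<^sub>M J)"
    unfolding w_def indicator_def Un_iff lessThan_iff atMost_iff by measurable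
  have [measurable]: "(\<lambda>x. \<integral>y. w x y \<partial>J) \<in> borel_measurable borel"
    by measurable
  have split: "{1} \<union> {2..n} = {1..n}" using n by auto
  have "(\<integral>p'. F p' \<partial>hands n) = (\<integral>x. (\<integral>y. F (merge {1} {2..n} (x, y)) \<partial>J) \<partial>(\<Pi>\<^sub>M i\<in>{1::nat}. hand))"
    unfolding J_def hands_def
    by (rule iid_hands.product_integral_fold[of "{1}" "{2..n}" F, unfolded split])
       (use F_int in \<open>auto simp: hands_def\<close>)
  also have "\<dots> = (\<integral>x. (\<integral>y. indicat_real {p..} (x 1) * (2 * w (x 1) y - 1) \<partial>J) \<partial>(\<Pi>\<^sub>M i\<in>{1::nat}. hand))"
  proof -
    have "merge {1} {2..n} (x, y) 1 = x 1" for x y :: "nat \<Rightarrow> real" by (simp add: merge_def)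
    moreover have "w c (merge {1} {2..n} (x, y)) = w c y" for c and x y :: "nat \<Rightarrow> real"
      unfolding w_def by (intro prod.cong) (auto simp: merge_def)
    ultimately show ?thesis unfolding F_def by (simp only:)
  qed
  also have "\<dots> = (\<integral>x. indicat_real {p..} (x 1) * (2 * (\<integral>y. w (x 1) y \<partial>J) - 1) \<partial>(\<Pi>\<^sub>M i\<in>{1::nat}. hand))"
    using wI by (simp add: J.prob_space)
  also have "\<dots> = (\<integral>x. indicat_real {p..} x * (2 * (\<integral>y. w x y \<partial>J) - 1) \<partial>hand)"
    by (rule iid_hands.product_integral_singleton) measurable
  also have "\<dots> = (\<integral>x. indicat_real {p..} x * (2 * (\<Prod>i\<in>{2..n}. max (q i) x) - 1) \<partial>hand)"
  proof (rule integral_cong_AE)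
    have "AE x in hand. x \<in> {0..1}"
      by (rule AE_uniform_measureI) auto
    thus "AE x in hand. indicat_real {p..} x * (2 * (\<integral>y. w x y \<partial>J) - 1) =
        indicat_real {p..} x * (2 * (\<Prod>i\<in>{2..n}. max (q i) x) - 1)"
      by eventually_elim (simp only: wE)
  qed measurable
  also have "\<dots> = integral {0..1} (\<lambda>x. indicat_real {p..} x * (2 * (\<Prod>i\<in>{2..n}. max (q i) x) - 1))"
  proof (rule integral_hand)
    have "set_integrable lborel {p..1} (\<lambda>x. 2 * (\<Prod>i\<in>{2..n}. max (q i) x) - 1)"
      by (intro borel_integrable_atLeastAtMost' continuous_intros)
    also have "?this \<longleftrightarrow> set_integrable lborel {0..1}
        (\<lambda>x. indicat_real {p..} x * (2 * (\<Prod>i\<in>{2..n}. max (q i) x) - 1))"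
      unfolding set_integrable_def using p
      by (intro Bochner_Integration.integrable_cong refl) (auto simp: indicator_def)
    finally show "set_integrable lborel {0..1}
        (\<lambda>x. indicat_real {p..} x * (2 * (\<Prod>i\<in>{2..n}. max (q i) x) - 1))" .
  qed measurable
  also have "\<dots> = integral {p..1} (\<lambda>x. 2 * (\<Prod>i\<in>{2..n}. max (q i) x) - 1)"
  proof -
    have "(\<lambda>x. indicat_real {p..} x * (2 * (\<Prod>i\<in>{2..n}. max (q i) x) - 1))
        = (\<lambda>x. if x \<in> {p..} then 2 * (\<Prod>i\<in>{2..n}. max (q i) x) - 1 else 0)"
      by (auto simp: indicator_def)
    moreover have "{p..} \<inter> {0..1} = {p..1}" using p by auto
    ultimately show ?thesis by (simp only: integral_restrict_Int)
  qed
  finally have F: "(\<integral>p'. F p' \<partial>hands n) = \<dots>" .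
  have "alpha n p q = (\<integral>p'. stakes_factor n (q(1 := p)) p' - 1 + real n * F p' \<partial>hands n)"
    unfolding alpha_def F_def w_def using n by (subst immediate_return_eq) (auto intro!: Bochner_Integration.integral_cong)
  also have "\<dots> = beta n p q - 1 + real n * (\<integral>p'. F p' \<partial>hands n)"
    unfolding beta_def using F_int stakes_factor_integrable[of n "q(1:=p)"] by (simp add: prob_space)
  finally show ?thesis unfolding F .
qed

section \<open>Two-point mixtures\<close>

lemma joint_strategy_space_component:
  assumes "i \<in> {2..n}"
  shows "(\<lambda>q. q i) \<in> borel_measurable (joint_strategy_space n)"
proof -
  have "(\<lambda>q. q i) \<in> joint_strategy_space n \<rightarrow>\<^sub>M restrict_space borel {0..1}"
    unfolding joint_strategy_space_def using assms by measurable
  thus ?thesis by (simp add: measurable_restrict_space2_iff)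
qed

lemma in_joint_strategy_space:
  "q \<in> space (joint_strategy_space n) \<Longrightarrow> i \<in> {2..n} \<Longrightarrow> q i \<in> {0..1}"
  by (auto simp: joint_strategy_space_def space_PiM PiE_def space_restrict_space)

text \<open>
  Measurability in the joint strategy is needed to evaluate the averages over a mixture: without
  it the Bochner integral is \<open>0\<close> by convention. The closed forms supply it.
\<close>

lemma beta_measurable:
  assumes "n \<ge> 1" "p \<in> {0..1}"
  shows "beta n p \<in> borel_measurable (joint_strategy_space n)"
proof -
  note [measurable] = joint_strategy_space_component
  have "(\<lambda>q. (\<Sum>i\<in>{2..n}. 1 - q i) - p + 2 * p * (\<Prod>i\<in>{2..n}. q i))
      \<in> borel_measurable (joint_strategy_space n)"
    by measurable
  also have "?this \<longleftrightarrow> ?thesis"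
    by (intro measurable_cong beta_eq[symmetric] assms in_joint_strategy_space)
  finally show ?thesis .
qed

lemma alpha_measurable:
  assumes "n \<ge> 1" "p \<in> {0..1}"
  shows "alpha n p \<in> borel_measurable (joint_strategy_space n)"
proof -
  define f where "f = (\<lambda>q x. indicat_real {p..1} x *\<^sub>R (2 * (\<Prod>i\<in>{2..n}. max (q i) x) - 1))"
  have [measurable]: "(\<lambda>z. fst z i) \<in> borel_measurable (joint_strategy_space n \<Otimes>\<^sub>M lborel)"
    if "i \<in> {2..n}" for i
    by (rule measurable_compose[OF measurable_fst joint_strategy_space_component[OF that]])
  have "case_prod f \<in> borel_measurable (joint_strategy_space n \<Otimes>\<^sub>M lborel)"
    unfolding f_def case_prod_beta' by measurable
  from lborel.borel_measurable_lebesgue_integral[OF this]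
  have "(\<lambda>q. beta n p q - 1 + n * (\<integral>x\<in>{p..1}. 2 * (\<Prod>i\<in>{2..n}. max (q i) x) - 1 \<partial>lborel))
      \<in> borel_measurable (joint_strategy_space n)"
    unfolding set_lebesgue_integral_def f_def
    by (intro borel_measurable_add borel_measurable_diff borel_measurable_times
          beta_measurable assms borel_measurable_const)
  also have "?this \<longleftrightarrow> ?thesis"
  proof (rule measurable_cong)
    fix q assume q: "q \<in> space (joint_strategy_space n)"
    have "set_integrable lborel {p..1} (\<lambda>x. 2 * (\<Prod>i\<in>{2..n}. max (q i) x) - 1)"
      by (intro borel_integrable_atLeastAtMost' continuous_intros)
    thus "beta n p q - 1 + n * (\<integral>x\<in>{p..1}. 2 * (\<Prod>i\<in>{2..n}. max (q i) x) - 1 \<partial>lborel) = alpha n p q"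
      using q assms by (subst alpha_eq) (auto simp: set_borel_integral_eq_integral dest: in_joint_strategy_space)
  qed
  finally show ?thesis .
qed

lemma beta_mixed_nonneg: "beta_mixed n p \<nu> \<ge> 0"
  unfolding beta_mixed_def by (rule Bochner_Integration.integral_nonneg) (rule beta_nonneg)

lemma two_point_mix_measurable:
  assumes "A \<in> space (joint_strategy_space n)" "B \<in> space (joint_strategy_space n)"
  shows "(\<lambda>b. if b then B else A) \<in> measure_pmf (bernoulli_pmf w) \<rightarrow>\<^sub>M joint_strategy_space n"
  using assms by (auto simp: measurable_def)

lemma integral_two_point_mix:
  fixes f :: "(nat \<Rightarrow> real) \<Rightarrow> real"
  assumes "A \<in> space (joint_strategy_space n)" "B \<in> space (joint_strategy_space n)"
    and "f \<in> borel_measurable (joint_strategy_space n)" and "w \<in> {0..1}"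
  shows "(\<integral>q. f q \<partial>two_point_mix n w A B) = (1 - w) * f A + w * f B"
  unfolding two_point_mix_def using assms(4)
  by (subst integral_distr[OF two_point_mix_measurable[OF assms(1,2)] assms(3)]) simp

lemma mixed_joint_strategy_two_point_mix:
  assumes "A \<in> space (joint_strategy_space n)" "B \<in> space (joint_strategy_space n)"
  shows "mixed_joint_strategy n (two_point_mix n w A B)"
  unfolding mixed_joint_strategy_def two_point_mix_def
  by (auto intro!: measure_pmf.prob_space_distr two_point_mix_measurable assms)

section \<open>A criterion for winning\<close>

text \<open>
  If no forced bound were negative, multiplying \<open>beta_mixed \<le> \<beta>\<^sub>0\<close> by them would give
  \<open>h (Suc k) \<le> \<beta>\<^sub>0 * h k - s\<close>, hence \<open>h k \<le> \<beta>\<^sub>0 ^ k\<close>, and the loss \<open>s\<close> would eventually exceed the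
  vanishing first term. A uniform \<open>s\<close> is needed here: negativity of \<open>alpha_mixed\<close> at each
  threshold separately would not give a strict gain after taking the supremum.
\<close>

lemma winning_strategyI:
  assumes \<nu>: "mixed_joint_strategy n \<nu>" and s: "s > 0" and "\<beta>\<^sub>0 < 1"
    and \<alpha>: "\<And>p. p \<in> {0..1} \<Longrightarrow> alpha_mixed n p \<nu> \<le> - s"
    and \<beta>: "\<And>p. p \<in> {0..1} \<Longrightarrow> beta_mixed n p \<nu> \<le> \<beta>\<^sub>0"
  shows "winning_strategy n \<nu>"
proof -
  have "\<exists>k. forced_bound n \<nu> k < 0"
  proof (rule ccontr)
    assume "\<not> (\<exists>k. forced_bound n \<nu> k < 0)"
    hence nonneg: "forced_bound n \<nu> k \<ge> 0" for k by (auto simp: not_less)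
    have step: "forced_bound n \<nu> (Suc k) \<le> \<beta>\<^sub>0 * forced_bound n \<nu> k - s" for k
      unfolding forced_bound.simps
    proof (rule cSUP_least)
      fix p :: real assume p: "p \<in> {0..1}"
      show "alpha_mixed n p \<nu> + beta_mixed n p \<nu> * forced_bound n \<nu> k
              \<le> \<beta>\<^sub>0 * forced_bound n \<nu> k - s"
        using \<alpha>[OF p] mult_right_mono[OF \<beta>[OF p] nonneg[of k]] by linarith
    qed auto
    have "\<beta>\<^sub>0 \<ge> 0" using beta_mixed_nonneg[of n 0 \<nu>] \<beta>[of 0] by simp
    have pow: "forced_bound n \<nu> k \<le> \<beta>\<^sub>0 ^ k" for k
    proof (induction k)
      case (Suc k)
      show ?case
        using step[of k] mult_left_mono[OF Suc \<open>\<beta>\<^sub>0 \<ge> 0\<close>] s by simp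
    qed auto
    have "(\<lambda>k. \<beta>\<^sub>0 ^ k) \<longlonglongrightarrow> 0"
      using \<open>\<beta>\<^sub>0 \<ge> 0\<close> \<open>\<beta>\<^sub>0 < 1\<close> by (intro LIMSEQ_power_zero) auto
    from order_tendstoD(2)[OF this s] obtain k where k: "\<beta>\<^sub>0 ^ k < s"
      by (auto simp: eventually_sequentially)
    have "\<beta>\<^sub>0 * forced_bound n \<nu> k \<le> 1 * forced_bound n \<nu> k"
      using nonneg[of k] \<open>\<beta>\<^sub>0 < 1\<close> by (intro mult_right_mono) auto
    with step[of k] pow[of k] k nonneg[of "Suc k"] show False by linarith
  qed
  then obtain k where "ereal (forced_bound n \<nu> k) < 0" by auto
  thus ?thesis unfolding winning_strategy_def using \<nu> by (auto simp: INF_less_iff)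
qed

section \<open>The break-even threshold\<close>

lemma p_circ_power: "n \<ge> 2 \<Longrightarrow> p_circ n ^ (n - 1) = 1 / 2"
  by (simp add: p_circ_def powr_powr powr_realpow[symmetric] of_nat_diff del: powr_realpow)

lemma p_circ_bounds:
  assumes "n \<ge> 2"
  shows "p_circ n \<ge> 1 / 2" "p_circ n < 1"
proof -
  have pos: "p_circ n > 0" by (simp add: p_circ_def)
  show lt: "p_circ n < 1"
  proof (rule ccontr)
    assume "\<not> p_circ n < 1"
    hence "1 \<le> p_circ n ^ (n - 1)" by (intro one_le_power) auto
    thus False using p_circ_power[OF assms] by simp
  qed
  have "p_circ n ^ (n - 1) \<le> p_circ n ^ 1"
    using assms pos lt by (intro power_decreasing) auto
  thus "p_circ n \<ge> 1 / 2" using p_circ_power[OF assms] by simp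
qed

text \<open>Bernoulli's inequality for \<open>(1 / r) ^ (n - 1) = 2\<close>, rather than for \<open>r\<close> itself.\<close>

lemma mean_holders_le_p_circ:
  assumes "n \<ge> 2"
  shows "(real n - 1) * (1 - p_circ n) \<le> p_circ n"
proof -
  define r where "r = p_circ n"
  have r: "r > 0" "r ^ (n - 1) = 1 / 2"
    using p_circ_bounds[OF assms] p_circ_power[OF assms] by (auto simp: r_def)
  have "1 + real (n - 1) * (1 / r - 1) \<le> (1 + (1 / r - 1)) ^ (n - 1)"
    using r by (intro Bernoulli_inequality) auto
  also have "\<dots> = 2" by (simp add: power_one_over r(2) del: One_nat_def)
  finally show ?thesis using r assms unfolding r_def[symmetric]
    by (simp add: field_simps of_nat_diff)
qed

section \<open>Opponents with a common threshold\<close>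

text \<open>The first two terms of the binomial expansion.\<close>

lemma power_add_ge:
  assumes "0 \<le> a" "0 \<le> (d::real)"
  shows "a ^ Suc k + real (Suc k) * a ^ k * d \<le> (a + d) ^ Suc k"
proof (induction k)
  case (Suc k)
  have "a ^ Suc (Suc k) + real (Suc (Suc k)) * a ^ Suc k * d
      \<le> (a + d) * (a ^ Suc k + real (Suc k) * a ^ k * d)"
    using assms by (simp add: algebra_simps)
  also have "\<dots> \<le> (a + d) * (a + d) ^ Suc k"
    using Suc assms by (intro mult_left_mono) auto
  finally show ?case by simp
qed auto

lemma integral_power_tail:
  assumes "0 \<le> a" "a \<le> (1::real)" "n \<ge> 1"
  shows "real n * integral {a..1} (\<lambda>x. 2 * x ^ (n - 1) - 1) = 2 * (1 - a ^ n) - real n * (1 - a)"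
proof -
  have "((\<lambda>x. 2 * x ^ (n - 1) - 1) has_integral
      (2 * 1 ^ n / real n - 1) - (2 * a ^ n / real n - a)) {a..1}"
    using assms
    by (intro fundamental_theorem_of_calculus)
       (auto intro!: derivative_eq_intros simp flip: has_real_derivative_iff_has_vector_derivative)
  thus ?thesis using assms by (simp add: integral_unique field_simps)
qed

text \<open>
  The two closed forms meet at \<open>p = a\<close> with the value \<open>0\<close>, as they must: there all players use the
  same threshold in a zero-sum game.
\<close>

lemma alpha_symmetric_above:
  assumes n: "n \<ge> 2" and a: "0 \<le> a" and p: "a \<le> p" "p \<le> 1" and q: "\<And>i. i \<in> {2..n} \<Longrightarrow> q i = a"
  shows "alpha n p q = (real n - 1) * (p - a) - 2 * p * (p ^ (n - 1) - a ^ (n - 1))"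
proof -
  have "integral {p..1} (\<lambda>x. 2 * (\<Prod>i\<in>{2..n}. max (q i) x) - 1)
      = integral {p..1} (\<lambda>x. 2 * x ^ (n - 1) - 1)"
    using p q by (intro integral_cong) (auto simp: max_def)
  moreover have "p ^ n = p * p ^ (n - 1)" using n by (cases n) auto
  ultimately show ?thesis
    using assms integral_power_tail[of p n] n
    by (subst alpha_eq, force, force, force, subst beta_eq) (auto simp: algebra_simps of_nat_diff)
qed

lemma alpha_symmetric_below:
  assumes n: "n \<ge> 2" and a: "a \<le> 1" and p: "0 \<le> p" "p \<le> a" and q: "\<And>i. i \<in> {2..n} \<Longrightarrow> q i = a"
  shows "alpha n p q = - (real n - 1) * (1 - 2 * a ^ (n - 1)) * (a - p)"
proof -
  let ?f = "\<lambda>x. 2 * (\<Prod>i\<in>{2..n}. max (q i) x) - 1"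
  have "integral {p..1} ?f = integral {p..a} ?f + integral {a..1} ?f"
    using p a by (intro Henstock_Kurzweil_Integration.integral_combine[symmetric] integrable_continuous_interval continuous_intros) auto
  also have "integral {p..a} ?f = integral {p..a} (\<lambda>x. 2 * a ^ (n - 1) - 1)"
    using p q by (intro integral_cong) (auto simp: max_def)
  also have "integral {a..1} ?f = integral {a..1} (\<lambda>x. 2 * x ^ (n - 1) - 1)"
    using p q by (intro integral_cong) (auto simp: max_def)
  finally have "integral {p..1} ?f = (a - p) * (2 * a ^ (n - 1) - 1) +
      integral {a..1} (\<lambda>x. 2 * x ^ (n - 1) - 1)" using p by simp
  moreover have "beta n p q = (real n - 1) * (1 - a) - p + 2 * p * a ^ (n - 1)"
    using n a p q by (subst beta_eq) (auto simp: of_nat_diff)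
  ultimately have "alpha n p q = (real n - 1) * (1 - a) - p + 2 * p * a ^ (n - 1) - 1
      + n * ((a - p) * (2 * a ^ (n - 1) - 1) + integral {a..1} (\<lambda>x. 2 * x ^ (n - 1) - 1))"
    using n a p q by (subst alpha_eq) auto
  moreover have "real n * integral {a..1} (\<lambda>x. 2 * x ^ (n - 1) - 1)
      = 2 * (1 - a * a ^ (n - 1)) - real n * (1 - a)"
    using integral_power_tail[of a n] p a n by (cases n) auto
  ultimately show ?thesis by (simp add: algebra_simps del: One_nat_def)
qed

section \<open>One opponent who always holds\<close>

text \<open>
  An opponent with threshold \<open>0\<close> excludes that everybody drops, so \<open>p\<close> enters \<open>beta\<close> only through
  the term \<open>- p\<close>, and the integrand in \<open>alpha\<close> has values in \<open>[-1, 1]\<close>.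
\<close>

lemma alpha_lipschitz:
  assumes n: "n \<ge> 1" and p: "p \<in> {0..1}" "p' \<in> {0..1}" "p \<le> p'" and q: "\<And>i. i \<in> {2..n} \<Longrightarrow> q i \<in> {0..1}"
    and zero: "i \<in> {2..n}" "q i = 0"
  shows "\<bar>alpha n p q - alpha n p' q\<bar> \<le> (real n + 1) * (p' - p)"
proof -
  let ?f = "\<lambda>x. 2 * (\<Prod>i\<in>{2..n}. max (q i) x) - 1"
  have "integral {p..1} ?f = integral {p..p'} ?f + integral {p'..1} ?f"
    using p by (intro Henstock_Kurzweil_Integration.integral_combine[symmetric] integrable_continuous_interval continuous_intros) auto
  moreover have "norm (integral {p..p'} ?f) \<le> 1 * (p' - p)"
  proof (rule integral_bound)
    fix x assume x: "x \<in> {p..p'}"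
    have "0 \<le> (\<Prod>i\<in>{2..n}. max (q i) x)" "(\<Prod>i\<in>{2..n}. max (q i) x) \<le> 1"
      using x p q by (auto intro!: prod_nonneg prod_le_1)
    thus "norm (?f x) \<le> 1" by (auto simp: abs_le_iff)
  qed (use p in \<open>auto intro!: continuous_intros\<close>)
  ultimately have int: "integral {p..1} ?f = integral {p..p'} ?f + integral {p'..1} ?f"
      and le: "\<bar>integral {p..p'} ?f\<bar> \<le> p' - p"
    by auto
  have "(\<Prod>i\<in>{2..n}. q i) = 0" using zero by (intro prod_zero) auto
  hence beta: "beta n s q = (\<Sum>i\<in>{2..n}. 1 - q i) - s" if "s \<in> {0..1}" for s
    using beta_eq[where q = q, OF n that q] by simp
  have eq: "alpha n p q - alpha n p' q = (p' - p) + real n * integral {p..p'} ?f"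
    using alpha_eq[where q = q, OF n p(1) q] alpha_eq[where q = q, OF n p(2) q]
    unfolding int beta[OF p(1)] beta[OF p(2)] by (simp add: algebra_simps)
  have "\<bar>real n * integral {p..p'} ?f\<bar> \<le> real n * (p' - p)"
    using mult_left_mono[OF le, of "real n"] by (simp add: abs_mult)
  thus ?thesis using p eq by (simp add: algebra_simps)
qed

text \<open>
  The comparison is with \<open>\<delta> = 0\<close>, where the return is \<open>0\<close> because \<open>r ^ (n - 1) = 1 / 2\<close>. The
  term \<open>- (n - 2) \<delta>\<close> comes from the \<open>n - 2\<close> opponents who hold less often. The integrand
  increases only on an interval of length \<open>\<delta>\<close>, and there by at most \<open>2 (n - 2) \<delta>\<close>, which is the
  quadratic correction.
\<close>

lemma alpha_strategy_B_le:
  fixes n :: nat and \<delta> :: real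
  defines "r \<equiv> p_circ n"
  assumes n: "n \<ge> 3" and \<delta>: "\<delta> \<ge> 0" "r + \<delta> \<le> 1"
  shows "alpha n r (strategy_B n \<delta>) \<le> - (real n - 2) * \<delta> * (1 - 2 * real n * \<delta>)"
proof -
  define b where "b = r + \<delta>"
  define k where "k = n - 2"
  let ?q = "strategy_B n \<delta>"
  have r: "0 \<le> r" "r \<le> 1" "r ^ (n - 1) = 1 / 2" "r \<le> b" "b \<le> 1"
    using p_circ_bounds[of n] p_circ_power[of n] n \<delta> by (auto simp: r_def b_def)
  have ins: "{2..n} = insert 2 {3..n}" using n by auto
  have q: "?q i \<in> {0..1}" if "i \<in> {2..n}" for i
    using that r by (auto simp: strategy_B_def b_def r_def)
  have q2: "?q 2 = 0" and q3: "\<And>i. i \<in> {3..n} \<Longrightarrow> ?q i = b"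
    using n by (auto simp: strategy_B_def b_def r_def)
  have beta: "beta n r ?q = 1 + (real n - 2) * (1 - b) - r"
    using n r q q2 q3 by (subst beta_eq) (auto simp: ins of_nat_diff)
  let ?f = "\<lambda>x. 2 * (\<Prod>i\<in>{2..n}. max (?q i) x) - 1"
  let ?g = "\<lambda>x. 2 * x ^ (n - 1) - 1 :: real"
  have f: "?f x = 2 * x * max b x ^ k - 1" if "x \<ge> 0" for x
    using that q2 q3 by (simp add: ins k_def)
  have pow: "x ^ (n - 1) = x * x ^ k" for x :: real
  proof -
    have "n - 1 = Suc k" using n by (simp add: k_def)
    thus ?thesis by simp
  qed
  have int: "?f integrable_on {s..t}" "?g integrable_on {s..t}" for s t
    by (intro integrable_continuous_interval continuous_intros)+
  have "integral {r..1} ?f = integral {r..b} ?f + integral {b..1} ?f"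
    using r int by (intro Henstock_Kurzweil_Integration.integral_combine[symmetric]) auto
  also have "integral {b..1} ?f = integral {b..1} ?g"
  proof (rule integral_cong)
    fix x assume "x \<in> {b..1}"
    thus "?f x = ?g x" using f[of x] r by (simp add: pow max_absorb2 del: One_nat_def)
  qed
  also have "integral {r..b} ?f \<le> integral {r..b} (\<lambda>x. ?g x + 2 * real k * \<delta>)"
  proof (rule integral_le)
    fix x assume x: "x \<in> {r..b}"
    have "norm (b ^ k - x ^ k) \<le> real k * norm (b - x)"
      using x r by (intro norm_power_diff) auto
    also have "\<dots> \<le> real k * \<delta>" using x by (intro mult_left_mono) (auto simp: b_def)
    finally have "x * (b ^ k - x ^ k) \<le> 1 * (real k * \<delta>)"
      using x r \<delta> power_mono[of x b k] by (intro mult_mono') auto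
    thus "?f x \<le> ?g x + 2 * real k * \<delta>"
      using x r by (simp add: f pow algebra_simps del: One_nat_def)
  qed (auto intro!: integrable_continuous_interval continuous_intros)
  also have "\<dots> = integral {r..b} ?g + 2 * real k * \<delta> * \<delta>"
    using r int by (subst Henstock_Kurzweil_Integration.integral_add) (auto simp: b_def)
  also have "integral {r..b} ?g + 2 * real k * \<delta> * \<delta> + integral {b..1} ?g
      = integral {r..1} ?g + 2 * real k * \<delta> * \<delta>"
    using Henstock_Kurzweil_Integration.integral_combine[of r b 1 ?g] r int by simp
  finally have "real n * integral {r..1} ?f \<le> real n * integral {r..1} ?g + real n * (2 * real k * \<delta> * \<delta>)"
    using n by (subst distrib_left[symmetric], intro mult_left_mono) auto
  also have "real n * integral {r..1} ?g = 2 * (1 - r / 2) - real n * (1 - r)"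
    using integral_power_tail[of r n] r n by (cases n) auto
  finally have "alpha n r ?q \<le> 1 + (real n - 2) * (1 - b) - r - 1 +
      (2 * (1 - r / 2) - real n * (1 - r) + real n * (2 * real k * \<delta> * \<delta>))"
    using alpha_eq[of n r ?q] q r n beta by auto
  moreover have "real k = real n - 2" using n by (simp add: k_def of_nat_diff)
  ultimately show ?thesis by (simp add: b_def algebra_simps)
qed

section \<open>Lowering the common threshold\<close>

text \<open>
  With \<open>a = r - \<epsilon>\<close>, the number \<open>u = 1 - 2 a ^ (n - 1)\<close> measures the tilt and lies between
  \<open>m \<epsilon> / 2\<close> and \<open>2 m \<epsilon>\<close>. The return is \<open>- m u (a - p)\<close> for \<open>p \<le> a\<close> and at most
  \<open>m d (u - d / 2)\<close> for \<open>d = p - a \<ge> 0\<close>. The latter is at most \<open>m u\<^sup>2 / 2\<close>, and it is negative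
  of order \<open>d\<^sup>2\<close> as soon as \<open>d\<close> dominates \<open>u\<close>.
\<close>

lemma alpha_strategy_A_bounds:
  fixes n :: nat and \<epsilon> :: real
  defines "r \<equiv> p_circ n" and "m \<equiv> real n - 1"
  assumes n: "n \<ge> 2" and \<epsilon>: "0 < \<epsilon>" "4 * m * \<epsilon> \<le> 1" and p: "p \<in> {0..1}"
  shows alpha_strategy_A_le: "alpha n p (strategy_A n \<epsilon>) \<le> 2 * m ^ 3 * \<epsilon>\<^sup>2"
    and alpha_strategy_A_far: "8 * m * \<epsilon> \<le> \<eta> \<Longrightarrow> \<bar>p - r\<bar> \<ge> \<eta> \<Longrightarrow>
           alpha n p (strategy_A n \<epsilon>) \<le> - (\<eta> / 4) * \<epsilon>"
proof -
  define a where "a = r - \<epsilon>"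
  define u where "u = 1 - 2 * a ^ (n - 1)"
  have m: "m \<ge> 1" "real (n - 1) = m" using n by (auto simp: m_def)
  have \<epsilon>m: "\<epsilon> \<le> m * \<epsilon>" using m \<epsilon> mult_right_mono[of 1 m \<epsilon>] by simp
  hence \<epsilon>4: "4 * \<epsilon> \<le> 1" using \<epsilon>(2) by linarith
  have r: "r \<ge> 1 / 2" "r < 1" "r ^ (n - 1) = 1 / 2"
    using p_circ_bounds[of n] p_circ_power[of n] n by (auto simp: r_def)
  have a: "0 \<le> a" "a \<le> r" "a \<le> 1" using r \<epsilon>(1) \<epsilon>4 by (auto simp: a_def)
  have q: "strategy_A n \<epsilon> i = a" if "i \<in> {2..n}" for i
    using that by (simp add: strategy_A_def a_def r_def)
  have "norm (r ^ (n - 1) - a ^ (n - 1)) \<le> real (n - 1) * norm (r - a)"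
    using r a by (intro norm_power_diff) auto
  hence diff: "1 / 2 - a ^ (n - 1) \<le> m * \<epsilon>" using \<epsilon> m r(3) by (simp add: a_def del: One_nat_def)
  hence u_le: "u \<le> 2 * m * \<epsilon>" by (simp add: u_def)
  from diff have quarter: "a ^ (n - 1) \<ge> 1 / 4" using \<epsilon> by linarith
  \<comment> \<open>The derivative of \<open>x ^ (n - 1)\<close> at \<open>a\<close> is \<open>m b\<close>, so a lower bound on \<open>b\<close> controls both the
     size of the tilt \<open>u\<close> and the curvature of the return beyond \<open>a\<close>.\<close>
  define b where "b = a ^ (n - 2)"
  have nk: "n - 1 = Suc (n - 2)" using n by simp
  have ab: "a * b = a ^ (n - 1)" unfolding b_def nk by simp
  have b: "b \<ge> 1 / 4"
    using quarter ab mult_right_mono[of a 1 b] a by (simp add: b_def del: One_nat_def)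
  have incr: "a ^ (n - 1) + m * b * d \<le> (a + d) ^ (n - 1)" if "d \<ge> 0" for d
    using power_add_ge[of a d "n - 2"] a that unfolding nk[symmetric] m b_def by blast
  have "1 / 4 * (m * \<epsilon>) \<le> b * (m * \<epsilon>)"
    using b m \<epsilon> by (intro mult_right_mono) auto
  with incr[of \<epsilon>] have "a ^ (n - 1) + m * \<epsilon> / 4 \<le> r ^ (n - 1)"
    using \<epsilon>(1) unfolding a_def by (simp only: diff_add_cancel mult.assoc mult.left_commute[of m]) simp
  hence u_ge: "u \<ge> m * \<epsilon> / 2" using r(3) unfolding u_def by linarith
  have u0: "u \<ge> 0" using u_ge m \<epsilon> by (meson divide_nonneg_nonneg mult_nonneg_nonneg order_trans less_imp_le zero_le_one zero_le_numeral)
  have below: "alpha n p (strategy_A n \<epsilon>) = - m * u * (a - p)" if "p \<le> a"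
    using alpha_symmetric_below[OF n a(3) _ that q] p by (simp add: m_def u_def)
  have above: "alpha n p (strategy_A n \<epsilon>) \<le> m * ((p - a) * (u - (p - a) / 2))" if "a \<le> p"
  proof -
    define d where "d = p - a"
    have d: "d \<ge> 0" "p = a + d" using that by (auto simp: d_def)
    have "(a + d) * (m * b * d) \<le> p * (p ^ (n - 1) - a ^ (n - 1))"
      unfolding d(2)[symmetric] using incr[OF d(1)] p d(2) by (intro mult_left_mono) auto
    moreover have "m * (d * d) * (1 / 4) \<le> m * (d * d) * b"
      using b m d by (intro mult_left_mono) auto
    moreover have "(a + d) * (m * b * d) = m * d * a ^ (n - 1) + m * (d * d) * b"
      unfolding ab[symmetric] by (simp add: algebra_simps)
    moreover have "alpha n p (strategy_A n \<epsilon>) = m * d - 2 * (p * (p ^ (n - 1) - a ^ (n - 1)))"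
      using alpha_symmetric_above[OF n a(1) that _ q] p by (simp add: m_def d_def)
    ultimately have "alpha n p (strategy_A n \<epsilon>) \<le> m * d - 2 * (m * d * a ^ (n - 1)) - m * (d * d) / 2"
      by linarith
    also have "\<dots> = m * (d * (u - d / 2))" by (simp add: u_def algebra_simps)
    finally show ?thesis by (simp add: d_def)
  qed
  show "alpha n p (strategy_A n \<epsilon>) \<le> 2 * m ^ 3 * \<epsilon>\<^sup>2"
  proof (cases "p \<le> a")
    case True
    have "0 \<le> m * u * (a - p)" using True m u0 by simp
    moreover have "0 \<le> 2 * m ^ 3 * \<epsilon>\<^sup>2" using m by simp
    ultimately show ?thesis using below[OF True] by linarith
  next
    case False
    have "(p - a) * (u - (p - a) / 2) \<le> u\<^sup>2 / 2"
      using zero_le_power2[of "u - (p - a)"] by (simp add: power2_eq_square field_simps)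
    also have "u\<^sup>2 \<le> (2 * m * \<epsilon>)\<^sup>2" using u_le u0 by (intro power_mono)
    finally have "m * ((p - a) * (u - (p - a) / 2)) \<le> m * ((2 * m * \<epsilon>)\<^sup>2 / 2)"
      using m by (intro mult_left_mono) auto
    also have "\<dots> = 2 * m ^ 3 * \<epsilon>\<^sup>2" by (simp add: power2_eq_square power3_eq_cube)
    finally show ?thesis using above False by linarith
  qed
  show "alpha n p (strategy_A n \<epsilon>) \<le> - (\<eta> / 4) * \<epsilon>" if \<eta>: "8 * m * \<epsilon> \<le> \<eta>" "\<bar>p - r\<bar> \<ge> \<eta>"
  proof (cases "p \<le> a")
    case True
    have "\<epsilon> / 2 * (\<eta> / 2) \<le> u * (a - p)"
    proof (intro mult_mono)
      show "\<epsilon> / 2 \<le> u" using u_ge \<epsilon>m by linarith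
      show "\<eta> / 2 \<le> a - p" using True \<eta> \<epsilon>m \<epsilon>(1) unfolding a_def by linarith
      show "0 \<le> \<eta> / 2" using \<eta>(1) \<epsilon>m \<epsilon>(1) by linarith
    qed (fact u0)
    also have "\<dots> \<le> m * (u * (a - p))" using m u0 True mult_right_mono[of 1 m "u * (a - p)"] by simp
    finally show ?thesis using below[OF True] by (simp add: algebra_simps)
  next
    case False
    hence d: "p - a \<ge> \<eta>" using \<eta> \<epsilon>m \<epsilon>(1) unfolding a_def by linarith
    have \<eta>0: "\<eta> > 0" "\<epsilon> \<le> \<eta>" using \<eta>(1) \<epsilon>(1) \<epsilon>m by linarith+
    have "(p - a) * (u - (p - a) / 2) \<le> (p - a) * (- (\<eta> / 4))"
    proof (rule mult_left_mono)
      have "8 * m * \<epsilon> = 4 * (2 * m * \<epsilon>)" by simp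
      hence "4 * u \<le> \<eta>" using u_le \<eta>(1) by linarith
      thus "u - (p - a) / 2 \<le> - (\<eta> / 4)" using d by (simp add: field_simps)
    qed (use d \<eta>0 in linarith)
    also have "\<dots> \<le> - (\<eta> / 4) * \<epsilon>" using mult_left_mono[of \<epsilon> "p - a" "\<eta> / 4"] d \<eta>0 by (simp add: algebra_simps)
    finally have le: "(p - a) * (u - (p - a) / 2) \<le> - (\<eta> / 4) * \<epsilon>" .
    have "m * ((p - a) * (u - (p - a) / 2)) \<le> m * (- (\<eta> / 4) * \<epsilon>)"
      using le m by (intro mult_left_mono) auto
    also have "\<dots> \<le> 1 * (- (\<eta> / 4) * \<epsilon>)" using m \<eta>0 \<epsilon>(1) by (intro mult_right_mono_neg) auto
    finally show ?thesis using above False by linarith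
  qed
qed

section \<open>Bounds on the stakes factor\<close>

lemma beta_strategy_A_le:
  fixes n :: nat and \<epsilon> :: real
  assumes n: "n \<ge> 2" and \<epsilon>: "0 \<le> \<epsilon>" "\<epsilon> \<le> p_circ n" and p: "p \<in> {0..1}"
  shows "beta n p (strategy_A n \<epsilon>) \<le> p_circ n + (real n - 1) * \<epsilon>"
proof -
  define a where "a = p_circ n - \<epsilon>"
  have a: "0 \<le> a" "a \<le> p_circ n" "a \<le> 1" using \<epsilon> p_circ_bounds[OF n] by (auto simp: a_def)
  have q: "strategy_A n \<epsilon> i = a" if "i \<in> {2..n}" for i
    using that by (simp add: strategy_A_def a_def)
  have "a ^ (n - 1) \<le> 1 / 2"
    using power_mono[OF a(2,1), of "n - 1"] p_circ_power[OF n] by simp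
  hence "p * a ^ (n - 1) \<le> p * (1 / 2)" using p by (intro mult_left_mono) auto
  moreover have "beta n p (strategy_A n \<epsilon>) = (real n - 1) * (1 - a) - p + 2 * p * a ^ (n - 1)"
    using n a p q by (subst beta_eq) (auto simp: of_nat_diff)
  ultimately show ?thesis
    using mean_holders_le_p_circ[OF n] by (simp add: a_def algebra_simps)
qed

lemma beta_le:
  assumes n: "n \<ge> 1" and p: "p \<in> {0..1}" and q: "\<And>i. i \<in> {2..n} \<Longrightarrow> q i \<in> {0..1}"
  shows "beta n p q \<le> n"
proof -
  have "(\<Prod>i\<in>{2..n}. q i) \<le> 1" "0 \<le> (\<Prod>i\<in>{2..n}. q i)" using q by (auto intro!: prod_le_1 prod_nonneg)
  hence "p * (\<Prod>i\<in>{2..n}. q i) \<le> p * 1" using p by (intro mult_left_mono) auto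
  moreover have "(\<Sum>i\<in>{2..n}. 1 - q i) \<le> (\<Sum>i\<in>{2..n}. 1)" using q by (intro sum_mono) auto
  ultimately show ?thesis using beta_eq[OF n p q] p n by (auto simp: of_nat_diff)
qed

section \<open>The mixed strategy\<close>

theorem corollary7p16:
  fixes n :: nat
  assumes "n \<ge> 4"
  shows "\<exists>\<delta>>0. p_circ n + \<delta> \<le> 1 \<and> (\<exists>\<beta>\<^sub>0<1.
           \<forall>\<^sub>F C in at_top. \<forall>\<^sub>F \<epsilon> in at_right 0.
             let \<nu> = two_point_mix n (C * \<epsilon>\<^sup>2) (strategy_A n \<epsilon>) (strategy_B n \<delta>) in
               (\<forall>p1\<in>{0..1}. alpha_mixed n p1 \<nu> < 0 \<and> beta_mixed n p1 \<nu> \<le> \<beta>\<^sub>0)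
               \<and> winning_strategy n \<nu>)"
proof -
  define r where "r = p_circ n"
  define m where "m = real n - 1"
  \<comment> \<open>With this \<open>\<delta>\<close> the factor \<open>1 - 2 n \<delta>\<close> of the first-order loss is \<open>1 / 2\<close>, so that \<open>B\<close> costs player 1
     at least \<open>c\<close> at \<open>r\<close>; \<open>\<eta>\<close> is the radius on which the Lipschitz constant \<open>n + 1\<close> keeps half of it.\<close>
  define \<delta> where "\<delta> = 1 / (4 * real n)"
  define c where "c = (real n - 2) * \<delta> / 2"
  define \<eta> where "\<eta> = c / (2 * (real n + 1))"
  define \<beta>\<^sub>0 where "\<beta>\<^sub>0 = (1 + r) / 2"
  have r: "1 / 2 \<le> r" "r < 1" "r ^ (n - 1) = 1 / 2"
    using p_circ_bounds[of n] p_circ_power[of n] assms by (auto simp: r_def)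
  have m: "m \<ge> 3" using assms by (simp add: m_def)
  have pos: "\<delta> > 0" "c > 0" "\<eta> > 0" using assms by (auto simp: \<delta>_def c_def \<eta>_def)
  have r\<delta>: "r + \<delta> \<le> 1"
  proof -
    have "norm (1 ^ (n - 1) - r ^ (n - 1)) \<le> real (n - 1) * norm (1 - r)"
      using r by (intro norm_power_diff) auto
    hence "1 / 2 \<le> m * (1 - r)" using r assms by (simp add: m_def of_nat_diff)
    also have "\<dots> \<le> real n * (1 - r)" using r by (intro mult_right_mono) (auto simp: m_def)
    finally show ?thesis using assms by (simp add: \<delta>_def field_simps)
  qed
  define B where "B = strategy_B n \<delta>"
  have B: "B \<in> space (joint_strategy_space n)"
    using r r\<delta> pos by (auto simp: B_def strategy_B_def joint_strategy_space_def space_PiM space_restrict_space r_def)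
  have B01: "B i \<in> {0..1}" if "i \<in> {2..n}" for i
    using in_joint_strategy_space[OF B that] .
  have B0: "2 \<in> {2..n}" "B 2 = 0" using assms by (auto simp: B_def strategy_B_def)
  have \<alpha>B_r: "alpha n r B \<le> - c"
  proof -
    have "alpha n r B \<le> - (real n - 2) * \<delta> * (1 - 2 * real n * \<delta>)"
      using alpha_strategy_B_le[of n \<delta>] assms pos r\<delta> by (simp add: B_def r_def)
    also have "1 - 2 * real n * \<delta> = 1 / 2" using assms by (simp add: \<delta>_def)
    also have "- (real n - 2) * \<delta> * (1 / 2) = - c" by (simp add: c_def field_simps)
    finally show ?thesis .
  qed
  have \<alpha>B_lip: "alpha n p B \<le> alpha n r B + (real n + 1) * \<bar>p - r\<bar>" if p: "p \<in> {0..1}" for p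
    using alpha_lipschitz[of n p r B 2] alpha_lipschitz[of n r p B 2] B01 B0 assms p r
    by (cases "p \<le> r") (auto simp: abs_le_iff)
  have \<alpha>B_near: "alpha n p B \<le> - (c / 2)" if "p \<in> {0..1}" "\<bar>p - r\<bar> < \<eta>" for p
  proof -
    have "(real n + 1) * \<bar>p - r\<bar> \<le> (real n + 1) * \<eta>" using that by (intro mult_left_mono) auto
    also have "\<dots> = c / 2" by (simp add: \<eta>_def field_simps)
    finally show ?thesis using \<alpha>B_lip[OF that(1)] \<alpha>B_r by linarith
  qed
  have \<alpha>B_le: "alpha n p B \<le> real n + 1" if "p \<in> {0..1}" for p
  proof -
    have "(real n + 1) * \<bar>p - r\<bar> \<le> (real n + 1) * 1" using that r by (intro mult_left_mono) auto
    hence "alpha n r B + (real n + 1) * \<bar>p - r\<bar> \<le> 0 + (real n + 1) * 1"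
      using \<alpha>B_r pos by (intro add_mono) auto
    thus ?thesis using \<alpha>B_lip[OF that(1)] by simp
  qed
  have "\<forall>\<^sub>F C in at_top. \<forall>\<^sub>F \<epsilon> in at_right 0.
             let \<nu> = two_point_mix n (C * \<epsilon>\<^sup>2) (strategy_A n \<epsilon>) B in
               (\<forall>p1\<in>{0..1}. alpha_mixed n p1 \<nu> < 0 \<and> beta_mixed n p1 \<nu> \<le> \<beta>\<^sub>0)
               \<and> winning_strategy n \<nu>"
    \<comment> \<open>Near \<open>r\<close> the weighted loss \<open>C \<epsilon>\<^sup>2 c / 2\<close> must exceed the gain \<open>2 m ^ 3 \<epsilon>\<^sup>2\<close> by \<open>\<epsilon>\<^sup>2\<close>.\<close>
    using eventually_ge_at_top[of "(4 * m ^ 3 + 2) / c"]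
  proof eventually_elim
    case (elim C)
    have "(4 * m ^ 3 + 2) / c > 0" using m pos by (intro divide_pos_pos add_nonneg_pos) auto
    with elim have "C > 0" by linarith
    moreover have "4 * m ^ 3 + 2 \<le> C * c" using elim pos by (simp add: pos_divide_le_eq)
    ultimately have C: "C > 0" "4 * m ^ 3 + 2 \<le> C * c" by auto
    have small: "\<forall>\<^sub>F \<epsilon> in at_right 0. f \<epsilon> < b" if "(f \<longlongrightarrow> 0) (at_right 0)" "b > 0" for f and b :: real
      using order_tendstoD(2)[OF that] .
    have "\<forall>\<^sub>F \<epsilon> in at_right 0. 4 * m * \<epsilon> < 1" "\<forall>\<^sub>F \<epsilon> in at_right 0. 8 * m * \<epsilon> < \<eta>"
      "\<forall>\<^sub>F \<epsilon> in at_right 0. C * \<epsilon>\<^sup>2 < 1 / 2" "\<forall>\<^sub>F \<epsilon> in at_right 0. (real n + 1) * C * \<epsilon> < \<eta> / 16"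
      "\<forall>\<^sub>F \<epsilon> in at_right 0. m * \<epsilon> + C * \<epsilon>\<^sup>2 * n < (1 - r) / 2"
      using pos r by (auto intro!: small tendsto_eq_intros)
    thus ?case using eventually_at_right_less[of 0]
    proof eventually_elim
      case (elim \<epsilon>)
      define w where "w = C * \<epsilon>\<^sup>2"
      define A where "A = strategy_A n \<epsilon>"
      define \<nu> where "\<nu> = two_point_mix n w A B"
      have "\<epsilon> > 0" using elim by simp
      moreover from this have "1 * \<epsilon> \<le> m * \<epsilon>" using m by (intro mult_right_mono) auto
      moreover have "4 * (m * \<epsilon>) < 1" using elim by simp
      ultimately have \<epsilon>: "\<epsilon> > 0" "\<epsilon> \<le> r" using r by linarith+
      have w: "0 \<le> w" "w \<le> 1 / 2" using elim C by (auto simp: w_def)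
      have A: "A \<in> space (joint_strategy_space n)"
        using r \<epsilon> by (auto simp: A_def strategy_A_def joint_strategy_space_def space_PiM space_restrict_space r_def)
      have \<alpha>: "alpha_mixed n p \<nu> = (1 - w) * alpha n p A + w * alpha n p B" if "p \<in> {0..1}" for p
        unfolding alpha_mixed_def \<nu>_def using assms w that
        by (intro integral_two_point_mix A B alpha_measurable) auto
      have \<beta>: "beta_mixed n p \<nu> = (1 - w) * beta n p A + w * beta n p B" if "p \<in> {0..1}" for p
        unfolding beta_mixed_def \<nu>_def using assms w that
        by (intro integral_two_point_mix A B beta_measurable) auto
      \<comment> \<open>The first entry is the loss near \<open>r\<close>, the second the loss away from \<open>r\<close>.\<close>
      define s where "s = min (\<epsilon>\<^sup>2) (\<eta> / 16 * \<epsilon>)"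
      have s: "s > 0" using \<epsilon> pos by (simp add: s_def)
      have \<alpha>_le: "alpha_mixed n p \<nu> \<le> - s" if p: "p \<in> {0..1}" for p
      proof (cases "\<bar>p - r\<bar> < \<eta>")
        case True
        have "(1 - w) * alpha n p A \<le> (1 - w) * (2 * m ^ 3 * \<epsilon>\<^sup>2)"
          using alpha_strategy_A_le[of n \<epsilon> p] assms elim p w
          by (intro mult_left_mono) (auto simp: A_def m_def)
        also have "\<dots> \<le> 1 * (2 * m ^ 3 * \<epsilon>\<^sup>2)" using w m by (intro mult_right_mono) auto
        finally have "alpha_mixed n p \<nu> \<le> 2 * m ^ 3 * \<epsilon>\<^sup>2 + w * (- (c / 2))"
          unfolding \<alpha>[OF p] using mult_left_mono[OF \<alpha>B_near[OF p True] w(1)] by linarith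
        also have "\<dots> = (2 * m ^ 3 - C * c / 2) * \<epsilon>\<^sup>2" by (simp add: w_def algebra_simps)
        also have "\<dots> \<le> (- 1) * \<epsilon>\<^sup>2" using C by (intro mult_right_mono) auto
        finally show ?thesis by (simp add: s_def)
      next
        case False
        have "(1 - w) * alpha n p A \<le> (1 - w) * (- (\<eta> / 4) * \<epsilon>)"
          using alpha_strategy_A_far[of n \<epsilon> p \<eta>] assms elim p w False
          by (intro mult_left_mono) (auto simp: A_def m_def r_def)
        also have "\<dots> \<le> (1 / 2) * (- (\<eta> / 4) * \<epsilon>)"
          using w pos \<epsilon> by (intro mult_right_mono_neg) auto
        finally have "alpha_mixed n p \<nu> \<le> (1 / 2) * (- (\<eta> / 4) * \<epsilon>) + w * (real n + 1)"
          unfolding \<alpha>[OF p] using mult_left_mono[OF \<alpha>B_le[OF p] w(1)] by linarith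
        also have "w * (real n + 1) = ((real n + 1) * C * \<epsilon>) * \<epsilon>"
          by (simp add: w_def power2_eq_square algebra_simps)
        also have "\<dots> \<le> \<eta> / 16 * \<epsilon>" using elim by (intro mult_right_mono) auto
        finally have "alpha_mixed n p \<nu> \<le> - (\<eta> / 16 * \<epsilon>)" by (simp add: algebra_simps)
        thus ?thesis by (simp add: s_def)
      qed
      have \<beta>_le: "beta_mixed n p \<nu> \<le> \<beta>\<^sub>0" if p: "p \<in> {0..1}" for p
      proof -
        have "(1 - w) * beta n p A \<le> 1 * beta n p A"
          using w beta_nonneg by (intro mult_right_mono) auto
        also have "\<dots> \<le> r + m * \<epsilon>"
          using beta_strategy_A_le[of n \<epsilon> p] assms \<epsilon> p by (simp add: A_def m_def r_def)
        finally have "beta_mixed n p \<nu> \<le> r + m * \<epsilon> + w * n"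
          unfolding \<beta>[OF p] using mult_left_mono[OF beta_le[of n p B] w(1)] assms p B01 by auto
        also have "\<dots> \<le> \<beta>\<^sub>0" using elim by (simp add: w_def \<beta>\<^sub>0_def field_simps)
        finally show ?thesis .
      qed
      have "winning_strategy n \<nu>"
        using mixed_joint_strategy_two_point_mix[OF A B] s \<alpha>_le \<beta>_le r
        by (intro winning_strategyI[where s = s and \<beta>\<^sub>0 = \<beta>\<^sub>0]) (auto simp: \<nu>_def \<beta>\<^sub>0_def)
      moreover have "alpha_mixed n p \<nu> < 0" if "p \<in> {0..1}" for p
        using \<alpha>_le[OF that] s by linarith
      ultimately show ?case
        unfolding Let_def using \<beta>_le by (simp add: \<nu>_def w_def A_def)
    qed
  qed
  moreover have "\<beta>\<^sub>0 < 1" using r by (simp add: \<beta>\<^sub>0_def)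
  ultimately show ?thesis using pos(1) r\<delta> unfolding B_def r_def by blast
qed
end
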